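(* Let $\alpha : I \subset \mathbb{R} \to \mathbb{E}^4$ be a unit speed curve with nonzero curvatures $k_i$ ($i=1,2,3$) according to the parallel transport frame $\{T, M_1, M_2, M_3\}$ in $\mathbb{E}^4$. Then $\alpha$ is an osculating curve if and only if there are constants $\lambda_2, \lambda_3 \in \mathbb{R}$ such that $\lambda_2 k_1 + \lambda_3 k_3 + 1 = 0$ along $\alpha$.
   Context: $\mathbb{E}^4$ is $\mathbb{R}^4$ with the standard inner product $\langle\cdot,\cdot\rangle$; primes denote derivatives with respect to the arclength parameter $s$, and curves are sufficiently differentiable. A vector field along a unit speed curve $\alpha$ that is perpendicular to $T=\alpha'$ is called relatively parallel if its derivative is tangential (a multiple of $T$) along $\alpha$. A parallel transport frame of $\alpha$ is an orthonormal frame $\{T, M_1, M_2, M_3\}$ along $\alpha$ with $T=\alpha'$ and $M_1, M_2, M_3$ relatively parallel; its curvatures are $k_i = \langle T', M_i\rangle$, so that $T' = k_1M_1+k_2M_2+k_3M_3$ and $M_i' = -k_iT$ for $i=1,2,3$. An osculating curve (according to the parallel transport frame) is a curve whose position vector always lies in its osculating space $M_2^\perp = \{X\in\mathbb{E}^4 \mid \langle X, M_2\rangle = 0\}$, i.e. $\alpha(s) = \lambda_1(s)T(s) + \lambda_2(s)M_1(s) + \lambda_3(s)M_3(s)$ for some differentiable functions $\lambda_1,\lambda_2,\lambda_3$.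
   Formalization: "α is an osculating curve" is read up to translation (α − p is osculating for some constant p), since the curvature condition is translation invariant while ⟨α, M₂⟩ = 0 is not, so the literal "if" direction fails, e.g. for a suitably framed circle centred at the origin. *)

theory Defs
  imports "HOL-Analysis.Analysis"
begin

text \<open>
  Curves are parametrised over a nondegenerate interval \<open>I\<close>, which need not be open; derivatives
  are taken within \<open>I\<close>, hence are one-sided at endpoints that belong to \<open>I\<close>.
\<close>

definition tangent :: "real set \<Rightarrow> (real \<Rightarrow> real^4) \<Rightarrow> real \<Rightarrow> real^4" where
  "tangent I \<alpha> s = vector_derivative \<alpha> (at s within I)"

definition unit_speed_curve :: "real set \<Rightarrow> (real \<Rightarrow> real^4) \<Rightarrow> bool" where
  "unit_speed_curve I \<alpha> \<longleftrightarrow> \<alpha> differentiable_on I \<and> (\<forall>s\<in>I. norm (tangent I \<alpha> s) = 1)"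

definition relatively_parallel ::
  "real set \<Rightarrow> (real \<Rightarrow> real^4) \<Rightarrow> (real \<Rightarrow> real^4) \<Rightarrow> bool" where
  "relatively_parallel I \<alpha> X \<longleftrightarrow>
     (\<forall>s\<in>I. X s \<bullet> tangent I \<alpha> s = 0 \<and>
            (\<exists>c. (X has_vector_derivative c *\<^sub>R tangent I \<alpha> s) (at s within I)))"

text \<open>
  The index type \<open>3\<close> has exactly the elements \<open>1\<close>, \<open>2\<close> and \<open>3\<close> (where \<open>3 = 0\<close>).
  Orthogonality of the \<open>M i\<close> to the tangent is part of being relatively parallel.
\<close>

definition parallel_transport_frame ::
  "real set \<Rightarrow> (real \<Rightarrow> real^4) \<Rightarrow> (3 \<Rightarrow> real \<Rightarrow> real^4) \<Rightarrow> bool" where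
  "parallel_transport_frame I \<alpha> M \<longleftrightarrow>
     (\<forall>s\<in>I. norm (tangent I \<alpha> s) = 1) \<and>
     (\<forall>s\<in>I. \<forall>i j. M i s \<bullet> M j s = (if i = j then 1 else 0)) \<and>
     (\<forall>i. relatively_parallel I \<alpha> (M i))"

definition pt_curvature ::
  "real set \<Rightarrow> (real \<Rightarrow> real^4) \<Rightarrow> (3 \<Rightarrow> real \<Rightarrow> real^4) \<Rightarrow> 3 \<Rightarrow> real \<Rightarrow> real" where
  "pt_curvature I \<alpha> M i s = vector_derivative (tangent I \<alpha>) (at s within I) \<bullet> M i s"

definition osculating_space :: "(3 \<Rightarrow> real \<Rightarrow> real^4) \<Rightarrow> real \<Rightarrow> (real^4) set" where
  "osculating_space M s = {X. X \<bullet> M 2 s = 0}"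

text \<open>
  Membership depends on the choice of origin, whereas the tangent, the frame and the curvatures of
  a curve do not change when the curve is translated.
\<close>

definition osculating_curve ::
  "real set \<Rightarrow> (real \<Rightarrow> real^4) \<Rightarrow> (3 \<Rightarrow> real \<Rightarrow> real^4) \<Rightarrow> bool" where
  "osculating_curve I \<alpha> M \<longleftrightarrow> (\<forall>s\<in>I. \<alpha> s \<in> osculating_space M s)"

end

theory Submission
  imports Defs
begin

text \<open>
  Up to the translation by \<open>p\<close>, being an osculating curve means \<open>\<alpha> \<bullet> M\<^sub>2 = 0\<close>.  Differentiating
  this and dividing by \<open>k\<^sub>2\<close> gives \<open>\<alpha> \<bullet> T = 0\<close>, which makes both \<open>\<lambda>\<^sub>2 = \<alpha> \<bullet> M\<^sub>1\<close> and
  \<open>\<lambda>\<^sub>3 = \<alpha> \<bullet> M\<^sub>3\<close> constant; differentiating \<open>\<alpha> \<bullet> T = 0\<close> once more is the claimed relation.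
  Conversely, the relation says that \<open>\<alpha> - \<lambda>\<^sub>2 M\<^sub>1 - \<lambda>\<^sub>3 M\<^sub>3\<close> has derivative zero, and its constant
  value is the origin \<open>p\<close> to be used.
\<close>

text \<open>This makes derivatives within \<open>I\<close> unique, also at endpoints: a connected
  set that is not a singleton has no isolated point.\<close>

lemma nontrivial_interval_not_trivial_limit:
  fixes I :: "real set"
  assumes "is_interval I" "interior I \<noteq> {}" "s \<in> I"
  shows "at s within I \<noteq> bot"
proof -
  have "I \<noteq> {a}" for a
    using assms(2) by auto
  then show ?thesis
    using connected_imp_perfect[of I s] assms(1,3)
    by (auto simp: is_interval_connected trivial_limit_within)
qed

lemma has_vector_derivative_inner:
  assumes "(f has_vector_derivative f') (at s within S)"
    and "(g has_vector_derivative g') (at s within S)"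
  shows "((\<lambda>s. f s \<bullet> g s) has_vector_derivative (f s \<bullet> g' + f' \<bullet> g s)) (at s within S)"
  by (rule bounded_bilinear.has_vector_derivative[OF bounded_bilinear_inner assms])

text \<open>Serves to differentiate identities that are known on \<open>I\<close> only.\<close>

lemma has_vector_derivative_constant_on:
  assumes "(f has_vector_derivative f') (at s within S)"
    and "\<And>x. x \<in> S \<Longrightarrow> f x = c" "s \<in> S" "at s within S \<noteq> bot"
  shows "f' = 0"
proof -
  have "(f has_vector_derivative 0) (at s within S)"
    using assms(2,3) by (intro has_vector_derivative_transform[OF _ _ has_vector_derivative_const[of c]]) auto
  then show ?thesis
    using vector_derivative_unique_within[OF assms(4,1)] by blast
qed

text \<open>Otherwise the remainder \<open>v\<close> of the expansion, together with
  \<open>t\<close> and the three \<open>m i\<close>, would give five nonzero pairwise orthogonal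
  vectors in a space of dimension 4.\<close>

lemma orthonormal_frame_expansion:
  fixes t w :: "real^4" and m :: "3 \<Rightarrow> real^4"
  assumes t: "norm t = 1" "\<And>i. m i \<bullet> t = 0"
    and m: "\<And>i j. m i \<bullet> m j = (if i = j then 1 else 0)"
    and w: "w \<bullet> t = 0"
  shows "w = (\<Sum>i\<in>UNIV. (w \<bullet> m i) *\<^sub>R m i)"
proof (rule ccontr)
  define v where "v = w - (\<Sum>i\<in>UNIV. (w \<bullet> m i) *\<^sub>R m i)"
  assume "w \<noteq> (\<Sum>i\<in>UNIV. (w \<bullet> m i) *\<^sub>R m i)"
  then have "v \<noteq> 0"
    by (simp add: v_def)
  have vt: "v \<bullet> t = 0"
    by (simp add: v_def inner_diff_left inner_sum_left t w)
  have vm: "v \<bullet> m i = 0" for i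
    by (simp add: v_def inner_diff_left inner_sum_left m if_distrib cong: if_cong)
  \<comment> \<open>The count to five is made on a set, so coincidences among the vectors have to be
    excluded first.\<close>
  have mt: "m i \<noteq> t" for i
    using t by (metis inner_eq_zero_iff norm_zero zero_neq_one)
  have vnt: "v \<noteq> t" and vnm: "v \<noteq> m i" for i
    using vt vm[of i] \<open>v \<noteq> 0\<close> by auto
  have m0: "m i \<noteq> 0" for i
    using m[of i i] by auto
  have "inj m"
    by (metis (no_types, lifting) injI m zero_neq_one)
  then have "card (range m) = 3"
    by (simp add: card_image)
  moreover have "t \<notin> range m" and "v \<notin> insert t (range m)"
    using mt vnt vnm by auto
  ultimately have card: "card (insert v (insert t (range m))) = 5"
    by simp
  have "pairwise orthogonal (insert v (insert t (range m)))"
    using t vt vm m by (auto simp: pairwise_def orthogonal_def inner_commute)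
  moreover have "0 \<notin> insert v (insert t (range m))"
    using \<open>v \<noteq> 0\<close> t(1) m0 by (metis (no_types, lifting) imageE insertE norm_zero zero_neq_one)
  ultimately have "independent (insert v (insert t (range m)))"
    by (rule pairwise_orthogonal_independent)
  then have "card (insert v (insert t (range m))) \<le> DIM(real^4)"
    by (rule independent_card_le)
  with card show False
    by simp
qed

text \<open>Relative parallelism only provides some multiple \<open>c\<close> of the tangent.
  Differentiating \<open>M i \<bullet> T = 0\<close> and using \<open>T \<bullet> T = 1\<close>
  identifies \<open>c\<close> as minus the curvature.\<close>

lemma parallel_transport_frame_derivative:
  assumes ndg: "at s within I \<noteq> bot" and s: "s \<in> I"
    and diff: "tangent I \<alpha> differentiable_on I"
    and frame: "parallel_transport_frame I \<alpha> M"
  shows "(M i has_vector_derivative - pt_curvature I \<alpha> M i s *\<^sub>R tangent I \<alpha> s) (at s within I)"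
proof -
  let ?T = "tangent I \<alpha>" and ?T' = "vector_derivative (tangent I \<alpha>) (at s within I)"
  have "relatively_parallel I \<alpha> (M i)"
    using frame by (simp add: parallel_transport_frame_def)
  then obtain c where c: "(M i has_vector_derivative c *\<^sub>R ?T s) (at s within I)"
    using s unfolding relatively_parallel_def by blast
  have T': "(?T has_vector_derivative ?T') (at s within I)"
    using diff s by (simp add: differentiable_on_def vector_derivative_works)
  have perp: "M i x \<bullet> ?T x = 0" if "x \<in> I" for x
    using frame that by (auto simp: parallel_transport_frame_def relatively_parallel_def)
  have "M i s \<bullet> ?T' + c *\<^sub>R ?T s \<bullet> ?T s = 0"
    by (rule has_vector_derivative_constant_on[OF has_vector_derivative_inner[OF c T'] perp s ndg])
  moreover have "?T s \<bullet> ?T s = 1"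
    using frame s by (simp add: parallel_transport_frame_def norm_eq_1)
  ultimately have "c = - pt_curvature I \<alpha> M i s"
    by (simp add: pt_curvature_def inner_commute)
  with c show ?thesis
    by simp
qed

theorem theorem5:
  fixes I :: "real set" and \<alpha> :: "real \<Rightarrow> real^4" and M :: "3 \<Rightarrow> real \<Rightarrow> real^4"
  assumes "is_interval I" and "interior I \<noteq> {}"
    and "unit_speed_curve I \<alpha>"
    and "tangent I \<alpha> differentiable_on I"
    and "parallel_transport_frame I \<alpha> M"
    and "\<And>i s. s \<in> I \<Longrightarrow> pt_curvature I \<alpha> M i s \<noteq> 0"
  shows "(\<exists>p. osculating_curve I (\<lambda>s. \<alpha> s - p) M) \<longleftrightarrow>
         (\<exists>l2 l3. \<forall>s\<in>I. l2 * pt_curvature I \<alpha> M 1 s + l3 * pt_curvature I \<alpha> M 3 s + 1 = 0)"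
proof -
  let ?T = "tangent I \<alpha>" and ?k = "pt_curvature I \<alpha> M"
  note ndg = nontrivial_interval_not_trivial_limit[OF assms(1,2)]
  have M': "(M i has_vector_derivative - ?k i s *\<^sub>R ?T s) (at s within I)" if "s \<in> I" for i s
    using parallel_transport_frame_derivative[OF ndg[OF that] that assms(4,5)] .
  have \<alpha>': "(\<alpha> has_vector_derivative ?T s) (at s within I)" if "s \<in> I" for s
    using assms(3) that
    by (simp add: unit_speed_curve_def differentiable_on_def tangent_def
        flip: vector_derivative_works)
  have T1: "norm (?T s) = 1" and MT: "M i s \<bullet> ?T s = 0"
    and MM: "M i s \<bullet> M j s = (if i = j then 1 else 0)" if "s \<in> I" for i j s
    using assms(5) that by (auto simp: parallel_transport_frame_def relatively_parallel_def)
  have "convex I"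
    using assms(1) by (rule is_interval_convex)
  show ?thesis
  proof (intro iffI; elim exE)
    fix p
    assume p: "osculating_curve I (\<lambda>s. \<alpha> s - p) M"
    \<comment> \<open>The translated curve has the same tangent, so the frame and curvatures of
      \<open>\<alpha>\<close> serve it unchanged.\<close>
    define \<beta> where "\<beta> s = \<alpha> s - p" for s
    have \<beta>M2: "\<beta> s \<bullet> M 2 s = 0" if "s \<in> I" for s
      using p that by (simp add: osculating_curve_def osculating_space_def \<beta>_def)
    have \<beta>': "(\<beta> has_vector_derivative ?T s) (at s within I)" if "s \<in> I" for s
      unfolding \<beta>_def using \<alpha>'[OF that] by (auto intro!: derivative_eq_intros)
    \<comment> \<open>The other term of the product rule is \<open>T \<bullet> M i\<close>, which
      vanishes. The case \<open>i = 2\<close> yields \<open>\<beta>T\<close>; with that, every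
      \<open>i\<close> yields a constant \<open>l i\<close>.\<close>
    have \<beta>M': "((\<lambda>s. \<beta> s \<bullet> M i s) has_vector_derivative - ?k i s * (\<beta> s \<bullet> ?T s)) (at s within I)"
      if "s \<in> I" for i s
      using has_vector_derivative_inner[OF \<beta>'[OF that] M'[OF that, of i]] MT[OF that, of i]
      by (simp add: inner_commute)
    have \<beta>T: "\<beta> s \<bullet> ?T s = 0" if "s \<in> I" for s
      using has_vector_derivative_constant_on[OF \<beta>M'[OF that, of 2] \<beta>M2 that ndg[OF that]]
        assms(6)[OF that, of 2]
      by simp
    have "\<exists>c. \<forall>s\<in>I. \<beta> s \<bullet> M i s = c" for i
      using has_vector_derivative_zero_constant[OF \<open>convex I\<close>, of "\<lambda>s. \<beta> s \<bullet> M i s"] \<beta>M'[of _ i] \<beta>T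
      by (metis mult_zero_right)
    then obtain l where l: "\<beta> s \<bullet> M i s = l i" if "s \<in> I" for i s
      by metis
    have "l 1 * ?k 1 s + l 3 * ?k 3 s + 1 = 0" if s: "s \<in> I" for s
    proof -
      let ?T' = "vector_derivative ?T (at s within I)"
      have T': "(?T has_vector_derivative ?T') (at s within I)"
        using assms(4) s by (simp add: differentiable_on_def vector_derivative_works)
      have "\<beta> s \<bullet> ?T' + ?T s \<bullet> ?T s = 0"
        by (rule has_vector_derivative_constant_on
            [OF has_vector_derivative_inner[OF \<beta>'[OF s] T'] \<beta>T s ndg[OF s]])
      \<comment> \<open>Only \<open>\<beta>\<close> needs expanding, since pairing \<open>T'\<close>
        with \<open>M i\<close> is the curvature by definition. The tangential part is absent by
        \<open>\<beta>T\<close>.\<close>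
      moreover have "\<beta> s = (\<Sum>i\<in>UNIV. l i *\<^sub>R M i s)"
        using orthonormal_frame_expansion[OF T1[OF s] MT[OF s] MM[OF s] \<beta>T[OF s]] l[OF s] by simp
      then have "\<beta> s \<bullet> ?T' = (\<Sum>i\<in>UNIV. l i * ?k i s)"
        by (simp add: inner_sum_left pt_curvature_def inner_commute[of ?T'])
      \<comment> \<open>The osculating condition removes the middle term of the sum, leaving the two
        constants sought.\<close>
      moreover have "l 2 * ?k 2 s = 0"
        using l[OF s, of 2] \<beta>M2[OF s] by simp
      moreover have "?T s \<bullet> ?T s = 1"
        using T1[OF s] by (simp only: norm_eq_1)
      ultimately show ?thesis
        unfolding sum_3 by linarith
    qed
    then show "\<exists>l2 l3. \<forall>s\<in>I. l2 * ?k 1 s + l3 * ?k 3 s + 1 = 0"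
      by blast
  next
    fix l2 l3
    assume l: "\<forall>s\<in>I. l2 * ?k 1 s + l3 * ?k 3 s + 1 = 0"
    have zero: "((\<lambda>s. \<alpha> s - l2 *\<^sub>R M 1 s - l3 *\<^sub>R M 3 s) has_vector_derivative 0) (at s within I)"
      if s: "s \<in> I" for s
    proof -
      have "((\<lambda>s. \<alpha> s - l2 *\<^sub>R M 1 s - l3 *\<^sub>R M 3 s) has_vector_derivative
          ?T s - l2 *\<^sub>R (- ?k 1 s *\<^sub>R ?T s) - l3 *\<^sub>R (- ?k 3 s *\<^sub>R ?T s)) (at s within I)"
        by (intro has_vector_derivative_diff \<alpha>' s
            bounded_linear.has_vector_derivative[OF bounded_linear_scaleR_right] M')
      also have "?T s - l2 *\<^sub>R (- ?k 1 s *\<^sub>R ?T s) - l3 *\<^sub>R (- ?k 3 s *\<^sub>R ?T s)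
          = (l2 * ?k 1 s + l3 * ?k 3 s + 1) *\<^sub>R ?T s"
        by (simp add: algebra_simps)
      finally show ?thesis
        using l s by simp
    qed
    obtain p where p: "\<And>s. s \<in> I \<Longrightarrow> \<alpha> s - l2 *\<^sub>R M 1 s - l3 *\<^sub>R M 3 s = p"
      using has_vector_derivative_zero_constant[OF \<open>convex I\<close> zero] by blast
    have "\<alpha> s - p = l2 *\<^sub>R M 1 s + l3 *\<^sub>R M 3 s" if "s \<in> I" for s
      by (simp flip: p[OF that])
    \<comment> \<open>After translation only \<open>M 1\<close> and \<open>M 3\<close> components
      remain, and both are orthogonal to \<open>M 2\<close>.\<close>
    then have "osculating_curve I (\<lambda>s. \<alpha> s - p) M"
      using MM by (simp add: osculating_curve_def osculating_space_def inner_add_left)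
    then show "\<exists>p. osculating_curve I (\<lambda>s. \<alpha> s - p) M" ..
  qed
qed

end
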